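(* Let $k\ge 1$ and $n\ge 1$ be integers and let $T_n$ be any tree with $n$ vertices. If the vertices of $T_n$ are colored uniformly and independently with $k$ colors, the expected number of blocks is $$\mathbb{E}[X_{k}(T_n)] = \frac{(k-1)n+1}{k}.$$
   Context: Given a coloring of the vertices of a finite graph $G$ with $k$ colors, the blocks are the connected components of the subgraph of $G$ formed by all vertices and all edges whose two endpoints have the same color. $X_k(G)$ denotes the number of blocks when each vertex of $G$ receives independently a uniformly random color among $k$ colors. *)

theory Defs
  imports "Graph_Theory.Digraph_Component" "HOL-Probability.Probability"
    "HOL-Probability.Product_PMF"
begin

text \<open>
  Finite simple graphs are the symmetric digraphs of locale \<^locale>\<open>graph\<close>, where an undirected
  edge is a pair of opposite arcs. The constant \<^const>\<open>Digraph_Component.tree\<close> is unsuitable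
  for such graphs: its acyclicity condition also rules out the closed walk along an arc and back, so
  it never holds for a graph with an edge. Since there are neither loops nor parallel arcs, the
  undirected cycles are exactly the directed ones of length at least 3.
\<close>

definition acyclic_graph :: "('a, 'b) pre_digraph \<Rightarrow> bool" where
  "acyclic_graph G \<longleftrightarrow> graph G \<and> \<not> (\<exists>p. pre_digraph.cycle G p \<and> 3 \<le> length p)"

definition tree_graph :: "('a, 'b) pre_digraph \<Rightarrow> bool" where
  "tree_graph G \<longleftrightarrow> acyclic_graph G \<and> Digraph_Component.connected G"

definition mono_subgraph :: "('a, 'b) pre_digraph \<Rightarrow> ('a \<Rightarrow> 'c) \<Rightarrow> ('a, 'b) pre_digraph" where
  "mono_subgraph G c = \<lparr> verts = verts G, arcs = {e \<in> arcs G. c (tail G e) = c (head G e)},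
     tail = tail G, head = head G \<rparr>"

text \<open>For symmetric digraphs the strongly connected components are the connected components.\<close>

definition blocks :: "('a, 'b) pre_digraph \<Rightarrow> ('a \<Rightarrow> 'c) \<Rightarrow> ('a, 'b) pre_digraph set" where
  "blocks G c = pre_digraph.sccs (mono_subgraph G c)"

text \<open>The colors are \<open>0, \<dots>, k - 1\<close>; the value 0 outside \<open>V\<close> is a dummy.\<close>

definition random_coloring :: "nat \<Rightarrow> 'a set \<Rightarrow> ('a \<Rightarrow> nat) pmf" where
  "random_coloring k V = Pi_pmf V 0 (\<lambda>_. pmf_of_set {..<k})"

definition expected_blocks :: "nat \<Rightarrow> ('a, 'b) pre_digraph \<Rightarrow> real" where
  "expected_blocks k G =
     measure_pmf.expectation (random_coloring k (verts G)) (\<lambda>c. real (card (blocks G c)))"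

end

theory Submission
  imports Defs
begin

text \<open>
  A forest with \<open>n\<close> vertices and \<open>m\<close> edges has \<open>n - m\<close> components, because every edge joins two
  components of the forest formed by the other edges. The monochromatic edges of a tree form a
  forest, so the number of blocks is \<open>n\<close> minus the number of monochromatic edges. Each of the
  \<open>n - 1\<close> edges is monochromatic with probability \<open>1 / k\<close>, and linearity of expectation gives
  \<open>n - (n - 1) / k\<close>.
\<close>

section \<open>Counting the classes of a symmetric relation\<close>

text \<open>Since \<open>u\<close> and \<open>v\<close> lie in different classes, the new edge
  merges these two into one and leaves every other class as it is. Both orientations are inserted to
  keep the relation symmetric.\<close>

lemma card_rtrancl_classes_insert_edge:
  assumes "finite V" "sym R" "u \<in> V" "v \<in> V" "(u, v) \<notin> R\<^sup>*"
  shows "Suc (card ((\<lambda>x. (insert (u, v) (insert (v, u) R))\<^sup>* `` {x}) ` V)) =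
    card ((\<lambda>x. R\<^sup>* `` {x}) ` V)"
proof -
  define C where "C x = R\<^sup>* `` {x}" for x
  have sym: "(x, y) \<in> R\<^sup>* \<Longrightarrow> (y, x) \<in> R\<^sup>*" for x y
    using assms(2) by (meson sym_rtrancl symD)
  have trans: "(x, y) \<in> R\<^sup>* \<Longrightarrow> (y, z) \<in> R\<^sup>* \<Longrightarrow> (x, z) \<in> R\<^sup>*" for x y z
    by (rule rtrancl_trans)
  have C_iff: "y \<in> C x \<longleftrightarrow> (x, y) \<in> R\<^sup>*" for x y
    by (simp add: C_def)
  have C_eq: "C x = C y \<longleftrightarrow> (x, y) \<in> R\<^sup>*" for x y
    unfolding set_eq_iff C_iff by (meson sym trans rtrancl.rtrancl_refl)
  have merged: "(insert (u, v) (insert (v, u) R))\<^sup>* `` {x} =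
      (if x \<in> C u \<union> C v then C u \<union> C v else C x)" for x
  proof (rule set_eqI)
    fix y
    show "y \<in> (insert (u, v) (insert (v, u) R))\<^sup>* `` {x} \<longleftrightarrow>
        y \<in> (if x \<in> C u \<union> C v then C u \<union> C v else C x)"
      by (auto simp: C_iff rtrancl_insert simp flip: C_eq)
  qed
  have classes: "(\<lambda>x. (insert (u, v) (insert (v, u) R))\<^sup>* `` {x}) ` V =
      insert (C u \<union> C v) (C ` V - {C u, C v})" (is "?L = ?R")
  proof (rule equalityI; rule subsetI)
    fix S assume "S \<in> ?L"
    then obtain x where "x \<in> V" "S = (if x \<in> C u \<union> C v then C u \<union> C v else C x)"
      unfolding merged by auto
    then show "S \<in> ?R"
      by (auto simp: C_iff simp flip: C_eq split: if_splits)
  next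
    fix S assume "S \<in> ?R"
    then consider "S = C u \<union> C v" | x where "x \<in> V" "S = C x" "C x \<noteq> C u" "C x \<noteq> C v"
      by auto
    then show "S \<in> ?L"
    proof cases
      case 1
      then show ?thesis unfolding merged
        using assms(3) by (auto simp: C_iff intro!: image_eqI[of _ _ u])
    next
      case 2
      then have "x \<notin> C u \<union> C v" by (auto simp: C_iff simp flip: C_eq)
      with 2 show ?thesis unfolding merged by auto
    qed
  qed
  \<comment> \<open>The merged class must not be counted already: an old class containing both
    \<open>u\<close> and \<open>v\<close> would connect them in \<open>R\<close>.\<close>
  have new: "C u \<union> C v \<notin> C ` V"
  proof
    assume "C u \<union> C v \<in> C ` V"
    then obtain w where "C u \<union> C v = C w" by auto
    then have "u \<in> C w" "v \<in> C w" by (auto simp: C_iff set_eq_iff)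
    then show False using assms(5) by (auto simp: C_iff simp flip: C_eq)
  qed
  have "C u \<noteq> C v" using assms(5) by (simp add: C_eq)
  then have two: "card {C u, C v} = 2" by simp
  have sub: "{C u, C v} \<subseteq> C ` V" using assms by auto
  have fin: "finite (C ` V)" using assms(1) by simp
  have "2 \<le> card (C ` V)" using card_mono[OF fin sub] two by simp
  moreover have "card (C ` V - {C u, C v}) = card (C ` V) - 2"
    using card_Diff_subset[of "{C u, C v}"] sub two by simp
  moreover have "card (insert (C u \<union> C v) (C ` V - {C u, C v})) =
      Suc (card (C ` V - {C u, C v}))"
    using new fin by (intro card_insert_disjoint) auto
  ultimately have "Suc (card (insert (C u \<union> C v) (C ` V - {C u, C v}))) = card (C ` V)"
    by simp
  then show ?thesis unfolding classes C_def .
qed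

text \<open>Induction on \<open>R\<close>, removing one edge at a time. The last assumption says
  that every edge is a bridge; it also excludes loops, as the closure is reflexive. The factors 2
  arise because \<open>R\<close> contains each edge in both orientations.\<close>

lemma card_rtrancl_classes_forest:
  assumes "finite V" "R \<subseteq> V \<times> V" "sym R"
    and "\<And>u v. (u, v) \<in> R \<Longrightarrow> (u, v) \<notin> (R - {(u, v), (v, u)})\<^sup>*"
  shows "2 * card ((\<lambda>x. R\<^sup>* `` {x}) ` V) + card R = 2 * card V"
proof -
  have "finite R" using assms(1,2) finite_subset by blast
  then show ?thesis using assms(2-)
  proof (induction R rule: finite_psubset_induct)
    case (psubset R)
    show ?case
    proof (cases "R = {}")
      case True
      have "card ((\<lambda>x. {x}) ` V) = card V" by (rule card_image) simp
      then show ?thesis using True by (simp add: Image_def)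
    next
      case False
      then obtain u v where uv: "(u, v) \<in> R" by auto
      define S where "S = R - {(u, v), (v, u)}"
      have vu: "(v, u) \<in> R" using uv psubset.prems(2) by (meson symD)
      have R: "R = insert (u, v) (insert (v, u) S)" using uv vu by (auto simp: S_def)
      have nr: "(u, v) \<notin> S\<^sup>*" using psubset.prems(3)[OF uv] by (simp add: S_def)
      then have "u \<noteq> v" by auto
      have "sym S" using psubset.prems(2) by (auto simp: S_def sym_def)
      have "2 * card ((\<lambda>x. S\<^sup>* `` {x}) ` V) + card S = 2 * card V"
      proof (rule psubset.IH)
        show "S \<subset> R" using uv by (auto simp: S_def)
        show "S \<subseteq> V \<times> V" using psubset.prems(1) by (auto simp: S_def)
        show "sym S" by fact
        \<comment> \<open>Bridges remain bridges in a smaller relation, by monotonicity of the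
          closure.\<close>
        show "(x, y) \<notin> (S - {(x, y), (y, x)})\<^sup>*" if "(x, y) \<in> S" for x y
        proof -
          have "S - {(x, y), (y, x)} \<subseteq> R - {(x, y), (y, x)}" by (auto simp: S_def)
          then show ?thesis using psubset.prems(3)[of x y] that rtrancl_mono
            by (auto simp: S_def)
        qed
      qed
      moreover have "Suc (card ((\<lambda>x. R\<^sup>* `` {x}) ` V)) = card ((\<lambda>x. S\<^sup>* `` {x}) ` V)"
        unfolding R using psubset.prems(1) uv
        by (intro card_rtrancl_classes_insert_edge assms(1) \<open>sym S\<close> nr) auto
      moreover have "card R = card S + 2"
      proof -
        have "finite S" using psubset.hyps by (simp add: S_def)
        moreover have "(u, v) \<notin> insert (v, u) S" "(v, u) \<notin> S"
          using \<open>u \<noteq> v\<close> by (auto simp: S_def)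
        ultimately show ?thesis unfolding R by simp
      qed
      ultimately show ?thesis by simp
    qed
  qed
qed

section \<open>Components of acyclic graphs\<close>

text \<open>Otherwise a simple path from \<open>u\<close> to \<open>v\<close> avoiding the edge,
  closed up by the arc from \<open>v\<close> back to \<open>u\<close>, would be a forbidden
  cycle.\<close>

lemma acyclic_graph_edge_is_bridge:
  assumes "acyclic_graph G" "(u, v) \<in> arcs_ends G"
  shows "(u, v) \<notin> (arcs_ends G - {(u, v), (v, u)})\<^sup>*"
proof
  assume reach: "(u, v) \<in> (arcs_ends G - {(u, v), (v, u)})\<^sup>*"
  interpret graph G using assms(1) by (simp add: acyclic_graph_def)
  define H where "H = G\<lparr>arcs := {e \<in> arcs G. arc_to_ends G e \<notin> {(u, v), (v, u)}}\<rparr>"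
  have sub: "subgraph H G"
    by (auto simp: subgraph_def H_def compatible_def wf_digraph_def)
  interpret H: wf_digraph H using sub by blast
  have "arcs_ends H = arcs_ends G - {(u, v), (v, u)}"
    by (auto simp: arcs_ends_def arc_to_ends_def H_def)
  moreover have "u \<in> verts H"
    using assms(2) adj_in_verts by (simp add: H_def)
  ultimately have "u \<rightarrow>\<^sup>*\<^bsub>H\<^esub> v" using reach by (simp add: H.reachable_conv')
  then obtain p where p: "H.apath u p v" by (auto simp: H.reachable_apath)
  then have pG: "apath u p v" using sub by (rule subgraph_apath_imp_apath)
  have "u \<noteq> v" using assms(2) adj_not_same by auto
  \<comment> \<open>The path is neither empty, as \<open>u \<noteq> v\<close>, nor a single arc, as
    \<open>H\<close> has none from \<open>u\<close> to \<open>v\<close>. The closing arc then brings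
    the length to at least 3, the bound in \<open>acyclic_graph\<close>.\<close>
  have "2 \<le> length p"
  proof (rule ccontr)
    assume "\<not> 2 \<le> length p"
    then consider "p = []" | a where "p = [a]"
      by (cases p; cases "tl p") auto
    then show False
    proof cases
      case 1
      then show ?thesis using p \<open>u \<noteq> v\<close> by (simp add: H.apath_Nil_iff)
    next
      case 2
      then have "a \<in> arcs H" "tail H a = u" "head H a = v"
        using p by (auto simp: H.apath_Cons_iff H.apath_Nil_iff)
      then show ?thesis by (simp add: H_def arc_to_ends_def)
    qed
  qed
  obtain e where e: "e \<in> arcs G" "tail G e = v" "head G e = u"
    using arcs_ends_symmetric[OF sym_arcs assms(2)] by auto
  have "cycle (e # p)" unfolding cycle_def
    using pG e by (auto simp: apath_def awalk_Cons_iff intro!: exI[of _ v])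
  with \<open>2 \<le> length p\<close> show False
    using assms(1) by (auto simp: acyclic_graph_def)
qed

text \<open>By symmetry, the strong components are the reachability classes; without parallel arcs,
  arcs correspond to their pairs of ends. The count for relations therefore applies.\<close>

lemma card_sccs_acyclic_graph:
  assumes "acyclic_graph G"
  shows "2 * card (pre_digraph.sccs G) + card (arcs G) = 2 * card (verts G)"
proof -
  interpret graph G using assms by (simp add: acyclic_graph_def)
  have "scc_of u = (arcs_ends G)\<^sup>* `` {u}" if "u \<in> verts G" for u
    using that symmetric_reachable' by (auto simp: scc_of_def reachable_conv')
  then have "sccs_verts = (\<lambda>u. (arcs_ends G)\<^sup>* `` {u}) ` verts G"
    unfolding sccs_verts_conv_scc_of by (rule image_cong[OF refl])
  moreover have "card (arcs_ends G) = card (arcs G)"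
    unfolding arcs_ends_def by (rule card_image[OF inj_on_arc_to_ends])
  moreover have "2 * card ((\<lambda>u. (arcs_ends G)\<^sup>* `` {u}) ` verts G) + card (arcs_ends G) =
      2 * card (verts G)"
    using adj_in_verts sym_arcs acyclic_graph_edge_is_bridge[OF assms]
    by (intro card_rtrancl_classes_forest) (auto simp: symmetric_def)
  ultimately show ?thesis by (simp add: card_sccs_verts[symmetric])
qed

lemma card_arcs_tree_graph:
  assumes "tree_graph G"
  shows "card (arcs G) + 2 = 2 * card (verts G)"
proof -
  have acyclic: "acyclic_graph G" and conn: "Digraph_Component.connected G"
    using assms by (auto simp: tree_graph_def)
  interpret graph G using acyclic by (simp add: acyclic_graph_def)
  have "strongly_connected G"
    using sym_arcs conn by (rule symmetric_connected_imp_strongly_connected)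
  then have "card sccs = 1" by (simp add: strongly_connected_eq_iff)
  then show ?thesis using card_sccs_acyclic_graph[OF acyclic] by simp
qed

section \<open>Blocks of a random coloring\<close>

lemma acyclic_graph_mono_subgraph:
  assumes "acyclic_graph G"
  shows "acyclic_graph (mono_subgraph G c)"
proof -
  interpret graph G using assms by (simp add: acyclic_graph_def)
  have sub: "subgraph (mono_subgraph G c) G"
    by (auto simp: subgraph_def mono_subgraph_def compatible_def wf_digraph_def)
  have "symmetric (mono_subgraph G c)"
    using sym_arcs unfolding symmetric_conv mono_subgraph_def by fastforce
  then have "graph (mono_subgraph G c)"
    using no_multi_arcs
    by unfold_locales (auto simp: mono_subgraph_def no_loops arc_to_ends_def)
  moreover have "cycle p" if "pre_digraph.cycle (mono_subgraph G c) p" for p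
    using sub that by (rule subgraph_cycle)
  ultimately show ?thesis using assms by (auto simp: acyclic_graph_def)
qed

text \<open>The sum runs over arcs, so it counts each monochromatic edge twice; hence the division
  by 2.\<close>

lemma card_blocks_acyclic_graph:
  assumes "acyclic_graph G"
  shows "real (card (blocks G c)) = real (card (verts G)) -
    (\<Sum>e\<in>arcs G. of_bool (c (tail G e) = c (head G e))) / 2"
proof -
  interpret graph G using assms by (simp add: acyclic_graph_def)
  have "2 * card (blocks G c) + card {e \<in> arcs G. c (tail G e) = c (head G e)} =
      2 * card (verts G)"
    using card_sccs_acyclic_graph[OF acyclic_graph_mono_subgraph[OF assms, of c]]
    by (simp add: blocks_def mono_subgraph_def)
  moreover have "(\<Sum>e\<in>arcs G. of_bool (c (tail G e) = c (head G e))) =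
      real (card {e \<in> arcs G. c (tail G e) = c (head G e)})"
    by (simp add: sum.inter_filter[symmetric] of_bool_def)
  ultimately show ?thesis by linarith
qed

lemma expectation_random_coloring_same_color:
  assumes "k \<ge> 1" "finite V" "u \<in> V" "v \<in> V" "u \<noteq> v"
  shows "measure_pmf.expectation (random_coloring k V) (\<lambda>c. of_bool (c u = c v)) = 1 / real k"
proof -
  define p where "p = pmf_of_set {..<k}"
  have ne: "{..<k} \<noteq> {}" using assms(1) by (simp add: lessThan_empty_iff)
  have pmf_p: "pmf p x = (if x < k then 1 / k else 0)" for x
    unfolding p_def using ne by (simp add: pmf_of_set indicator_def)
  \<comment> \<open>Splitting off the coordinate \<open>u\<close> exhibits the colors of
    \<open>u\<close> and \<open>v\<close> as independent, with joint law
    \<open>pair_pmf p p\<close>.\<close>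
  have "Pi_pmf V 0 (\<lambda>_. p) = map_pmf (\<lambda>(y, f). f(u := y)) (pair_pmf p (Pi_pmf (V - {u}) 0 (\<lambda>_. p)))"
    using Pi_pmf_insert[of "V - {u}" u 0 "\<lambda>_. p"] assms by (simp add: insert_absorb)
  then have "map_pmf (\<lambda>c. (c u, c v)) (Pi_pmf V 0 (\<lambda>_. p)) =
      map_pmf (\<lambda>(y, f). (y, f v)) (pair_pmf p (Pi_pmf (V - {u}) 0 (\<lambda>_. p)))"
    using assms(5) by (simp add: pmf.map_comp o_def case_prod_unfold)
  also have "\<dots> = pair_pmf p (map_pmf (\<lambda>f. f v) (Pi_pmf (V - {u}) 0 (\<lambda>_. p)))"
    by (simp add: pair_map_pmf2 apsnd_def map_prod_def)
  also have "\<dots> = pair_pmf p p"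
    using assms by (simp add: Pi_pmf_component)
  finally have pair: "map_pmf (\<lambda>c. (c u, c v)) (Pi_pmf V 0 (\<lambda>_. p)) = pair_pmf p p" .
  have supp: "set_pmf (pair_pmf p p) \<subseteq> {..<k} \<times> {..<k}"
    using ne by (auto simp: p_def)
  have "measure_pmf.expectation (random_coloring k V) (\<lambda>c. of_bool (c u = c v)) =
      measure_pmf.expectation (map_pmf (\<lambda>c. (c u, c v)) (Pi_pmf V 0 (\<lambda>_. p)))
        (\<lambda>z. of_bool (fst z = snd z) :: real)"
    by (simp add: random_coloring_def p_def)
  also have "\<dots> = (\<Sum>z\<in>{..<k} \<times> {..<k}. pmf (pair_pmf p p) z * of_bool (fst z = snd z))"
    unfolding pair using supp
    by (subst integral_measure_pmf_real[of "{..<k} \<times> {..<k}"]) (auto simp: mult.commute)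
  \<comment> \<open>Only the \<open>k\<close> diagonal pairs contribute, each with mass
    \<open>1 / (real k * real k)\<close>.\<close>
  also have "\<dots> = (\<Sum>x<k. \<Sum>y<k. if x = y then 1 / (real k * real k) else 0)"
    unfolding sum.cartesian_product
    by (intro sum.cong refl) (auto simp: pmf_pair pmf_p of_bool_def split: if_splits)
  also have "\<dots> = 1 / real k"
    using assms(1) by simp
  finally show ?thesis .
qed

theorem corollary2p4:
  fixes k n :: nat and T :: "('a, 'b) pre_digraph"
  assumes "k \<ge> 1" and "n \<ge> 1"
    and "tree_graph T" and "card (verts T) = n"
  shows "expected_blocks k T = ((real k - 1) * real n + 1) / real k"
proof -
  have acyclic: "acyclic_graph T" using assms(3) by (simp add: tree_graph_def)
  interpret graph T using acyclic by (simp add: acyclic_graph_def)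
  let ?M = "random_coloring k (verts T)"
  let ?I = "\<lambda>e c. of_bool (c (tail T e) = c (head T e)) :: real"
  have int: "integrable (measure_pmf ?M) (?I e)" for e
    by (rule measure_pmf.integrable_const_bound[of _ 1]) auto
  have "expected_blocks k T =
      measure_pmf.expectation ?M (\<lambda>c. real n - (\<Sum>e\<in>arcs T. ?I e c) / 2)"
    unfolding expected_blocks_def card_blocks_acyclic_graph[OF acyclic] assms(4) ..
  also have "\<dots> = real n - (\<Sum>e\<in>arcs T. measure_pmf.expectation ?M (?I e)) / 2"
    using int by (simp del: sum_of_bool_eq)
  \<comment> \<open>Absence of loops makes the two ends of each arc distinct, as the probability
    \<open>1 / real k\<close> requires.\<close>
  also have "(\<Sum>e\<in>arcs T. measure_pmf.expectation ?M (?I e)) = (\<Sum>e\<in>arcs T. 1 / real k)"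
    using assms(1) no_loops
    by (intro sum.cong refl expectation_random_coloring_same_color) auto
  also have "\<dots> = (2 * real n - 2) / real k"
  proof -
    have "real (card (arcs T)) + 2 = 2 * real n"
      using card_arcs_tree_graph[OF assms(3)] assms(4) by linarith
    then show ?thesis by simp
  qed
  finally show ?thesis using assms(1) by (simp add: field_simps)
qed

end
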